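(* Let $G\subset\mathbb{C}$ be a hyperbolic plane domain and let $f:\mathbb{B}_n\to G$ be an analytic mapping, $a\in\mathbb{B}_n$, $b=f(a)$, $u\in T_a\mathbb{C}^n$ and $u_*=f'(a)u$. Then $$\mathrm{Hyp}_G(b)\,|u_*|_e\leq M_{\mathbb{B}_n}(a,u)\,|u|_e .$$ In particular, for $z\in\mathbb{B}_n$: (i) $\mathrm{Hyp}_G(f(z))\,|f'(z)|\leq 1/s_z^2$; (ii) $\mathrm{Hyp}_G(f(z))\,|\tilde{D}f(z)|\leq 1$.
   Context: $\mathbb{B}_n$ is the open unit ball of $\mathbb{C}^n$ with the standard Hermitian inner product $\langle\cdot,\cdot\rangle$; $|\cdot|_e$ is the Euclidean norm; $|f'(z)|$ is the operator norm of the complex-linear map $f'(z):\mathbb{C}^n\to\mathbb{C}$. For $a\in\mathbb{B}_n$ put $s_a=(1-|a|^2)^{1/2}$, let $P_a$ be the orthogonal projection onto the complex line spanned by $a$ ($P_0=0$), $Q_a=I-P_a$, and $\varphi_a(z)=\frac{a-P_az-s_aQ_az}{1-\langle z,a\rangle}$, a biholomorphic automorphism of $\mathbb{B}_n$ interchanging $0$ and $a$. For $u\neq0$, $M_{\mathbb{B}_n}(a,u)=|(d\varphi_a)_au|_e/|u|_e$. $Df(z)=(D_1f(z),\dots,D_nf(z))$ is the vector of complex partial derivatives $D_j=\partial/\partial z_j$, with $|Df(z)|=(\sum_j|D_jf(z)|^2)^{1/2}$, and the invariant gradient is $\tilde{D}f(a)=D(f\circ\varphi_a)(0)$. A plane domain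 $G$ is hyperbolic if its holomorphic universal covering is the unit disk $\mathbb{D}$. The hyperbolic density is normalized by $\mathrm{Hyp}_{\mathbb{D}}(z)=\frac{2}{1-|z|^2}$ (Gaussian curvature $-1$), and $\mathrm{Hyp}_G(\pi(z))|\pi'(z)|=\mathrm{Hyp}_{\mathbb{D}}(z)$ for a holomorphic universal covering $\pi:\mathbb{D}\to G$.
   Formalization: The right-hand sides of the main inequality, (i) and (ii) carry an extra factor 2: with Hyp_D = 2/(1-|z|^2) the printed bounds fail for n=1, G=D, f(z)=z (at z=0 they read 2 ≤ 1); the constant 2 is sharp. *)

theory Defs
  imports "HOL-Complex_Analysis.Complex_Analysis"
begin

text \<open>The unit disk is simply connected, so a holomorphic covering by it is universal.\<close>

definition disk_universal_covering :: "(complex \<Rightarrow> complex) \<Rightarrow> complex set \<Rightarrow> bool" where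
  "disk_universal_covering \<pi> G \<longleftrightarrow>
     \<pi> holomorphic_on ball 0 1 \<and> covering_space (ball 0 1) \<pi> G"

definition hyperbolic_domain :: "complex set \<Rightarrow> bool" where
  "hyperbolic_domain G \<longleftrightarrow>
     open G \<and> connected G \<and> (\<exists>\<pi>. disk_universal_covering \<pi> G)"

text \<open>
  Normalized to Gaussian curvature -1. The metric \<open>M_ball\<close> below restricts, in dimension one,
  to \<open>1 / (1 - (norm z)\<^sup>2)\<close> of curvature -4, so Schwarz-Pick inequalities from \<open>M_ball\<close> to
  \<open>hyp_density\<close> have the constant 2, which is attained by the identity of the disk.
\<close>

definition hyp_disk :: "complex \<Rightarrow> real" where
  "hyp_disk z = 2 / (1 - (norm z)\<^sup>2)"

text \<open>
  The value below depends neither on the covering nor on the point of the fibre; see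
  \<open>hyp_density_covering\<close>.
\<close>

definition hyp_density :: "complex set \<Rightarrow> complex \<Rightarrow> real" where
  "hyp_density G w =
     (THE d. \<exists>\<pi> z. disk_universal_covering \<pi> G \<and> z \<in> ball 0 1 \<and> \<pi> z = w \<and>
                   d * norm (deriv \<pi> z) = hyp_disk z)"

lemma disk_covering_deriv_nonzero:
  assumes "disk_universal_covering \<pi> G" "z \<in> ball 0 1"
  shows "deriv \<pi> z \<noteq> 0"
proof -
  have cov: "covering_space (ball 0 1) \<pi> G" and hol: "\<pi> holomorphic_on ball 0 1"
    using assms by (auto simp: disk_universal_covering_def)
  obtain T u q where T: "z \<in> T" "openin (top_of_set (ball 0 1)) T"
      "homeomorphism T u \<pi> q"
    by (rule covering_space_local_homeomorphism[OF cov assms(2)])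
  have "open T" "T \<subseteq> ball 0 1"
    using T(2) by (auto simp: openin_open_eq)
  moreover have "inj_on \<pi> T"
    using T(3) by (metis homeomorphism_def inj_on_inverseI)
  ultimately show ?thesis
    using holomorphic_injective_imp_regular[OF holomorphic_on_subset[OF hol]] T(1) by simp
qed

lemma schwarz_pick:
  assumes hol: "h holomorphic_on ball 0 1" and im: "h \<in> ball 0 1 \<rightarrow> ball 0 1"
    and z: "z \<in> ball (0::complex) 1"
  shows "norm (deriv h z) * hyp_disk (h z) \<le> hyp_disk z"
proof -
  define A where "A = (\<lambda>v. (v + z) / (1 + cnj z * v))"
  define B where "B = Moebius_function 0 (h z)"
  have nz: "norm z < 1" and nhz: "norm (h z) < 1" using z im by auto
  have AM: "A = Moebius_function 0 (- z)"
    by (auto simp: A_def Moebius_function_def fun_eq_iff)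
  have holA: "A holomorphic_on ball 0 1" and imA: "A \<in> ball 0 1 \<rightarrow> ball 0 1"
    unfolding AM using nz
    by (auto intro!: Moebius_function_holomorphic Moebius_function_norm_lt_1)
  have holB: "B holomorphic_on ball 0 1" and imB: "B \<in> ball 0 1 \<rightarrow> ball 0 1"
    unfolding B_def using nhz
    by (auto intro!: Moebius_function_holomorphic Moebius_function_norm_lt_1)
  define F where "F = (\<lambda>v. B (h (A v)))"
  have holF: "F holomorphic_on ball 0 1"
  proof -
    have "(h \<circ> A) holomorphic_on ball 0 1"
      using holA hol imA by (intro holomorphic_on_compose_gen[where t="ball 0 1"]) auto
    moreover note holB
    moreover have "(h \<circ> A) ` ball 0 1 \<subseteq> ball 0 1"
      using imA im unfolding image_subset_iff Pi_iff o_def by blast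
    ultimately have "(B \<circ> (h \<circ> A)) holomorphic_on ball 0 1"
      by (rule holomorphic_on_compose_gen)
    then show ?thesis by (simp add: F_def o_def)
  qed
  have A0: "A 0 = z" by (simp add: A_def)
  have F0: "F 0 = 0" by (simp add: F_def A0 B_def Moebius_function_eq_zero)
  have no: "norm (F v) < 1" if "norm v < 1" for v
    using that imA im imB by (auto simp: F_def Pi_iff)
  have le: "norm (deriv F 0) \<le> 1"
    using Schwarz_Lemma(2)[OF holF F0 no, of 0] by simp
  have dA: "(A has_field_derivative 1 - cnj z * z) (at 0)"
    unfolding A_def by (auto intro!: derivative_eq_intros simp: algebra_simps)
  have hne: "1 - cnj (h z) * h z \<noteq> 0"
  proof
    assume "1 - cnj (h z) * h z = 0"
    then have "norm (cnj (h z) * h z) = 1" by (simp del: norm_mult)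
    then have "norm (h z) * norm (h z) = 1" by (simp add: norm_mult)
    with nhz show False using mult_strict_mono[of "norm (h z)" 1 "norm (h z)" 1] by simp
  qed
  have dB: "(B has_field_derivative 1 / (1 - cnj (h z) * h z)) (at (h z))"
    unfolding B_def Moebius_function_def using hne
    by (auto intro!: derivative_eq_intros simp del: right_minus_eq)
  have dh: "(h has_field_derivative deriv h z) (at z)"
    using hol z by (simp add: holomorphic_derivI)
  have dh0: "((\<lambda>v. h (A v)) has_field_derivative deriv h z * (1 - cnj z * z)) (at 0)"
    using DERIV_chain2[of h "deriv h z" A 0, OF _ dA] dh A0 by simp
  have "(F has_field_derivative 1 / (1 - cnj (h z) * h z) * (deriv h z * (1 - cnj z * z))) (at 0)"
    unfolding F_def
    using DERIV_chain2[of B _ "\<lambda>v. h (A v)" 0, OF _ dh0] dB unfolding A0 by blast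
  then have dF: "deriv F 0 = 1 / (1 - cnj (h z) * h z) * (deriv h z * (1 - cnj z * z))"
    by (rule DERIV_imp_deriv)
  have n1: "norm (1 - cnj w * w) = 1 - (norm w)\<^sup>2" "1 - (norm w)\<^sup>2 > 0" if "norm w < 1" for w
  proof -
    have p: "(norm w)\<^sup>2 < 1"
      using that by (simp add: abs_square_less_1)
    have "1 - cnj w * w = of_real (1 - (norm w)\<^sup>2)"
      by (metis complex_norm_square mult.commute of_real_1 of_real_diff)
    then show "norm (1 - cnj w * w) = 1 - (norm w)\<^sup>2"
      using p by (simp only: norm_of_real)
    show "1 - (norm w)\<^sup>2 > 0" using p by simp
  qed
  have "norm (deriv h z) * (1 - (norm z)\<^sup>2) / (1 - (norm (h z))\<^sup>2) \<le> 1"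
    using le n1[OF nz] n1[OF nhz] unfolding dF by (simp add: norm_mult norm_divide)
  then show ?thesis
    using n1[OF nz] n1[OF nhz] unfolding hyp_disk_def by (simp add: field_simps)
qed

lemma hyp_density_unique:
  assumes 1: "disk_universal_covering \<pi> G" "z \<in> ball 0 1" "d * norm (deriv \<pi> z) = hyp_disk z"
    and 2: "disk_universal_covering \<rho> G" "y \<in> ball 0 1" "e * norm (deriv \<rho> y) = hyp_disk y"
    and eq: "\<pi> z = \<rho> y"
  shows "d \<le> e"
proof -
  have cov: "covering_space (ball 0 1) \<pi> G" "covering_space (ball 0 1) \<rho> G"
    and hol: "\<pi> holomorphic_on ball 0 1" "\<rho> holomorphic_on ball 0 1"
    using 1 2 by (auto simp: disk_universal_covering_def)
  have im: "\<rho> \<in> ball 0 1 \<rightarrow> G"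
    using covering_space_imp_surjective[OF cov(2)] by auto
  obtain h where h: "continuous_on (ball 0 1) h" "h \<in> ball 0 1 \<rightarrow> ball 0 1" "h y = z"
      "\<And>x. x \<in> ball 0 1 \<Longrightarrow> \<pi> (h x) = \<rho> x"
    using covering_space_lift_strong[OF cov(1) 1(2) 2(2), of \<rho>] im eq hol(2)
    by (metis convex_ball convex_imp_locally_path_connected convex_imp_simply_connected
        holomorphic_on_imp_continuous_on)
  have holh: "h holomorphic_on ball 0 1"
    using covering_space_lift_is_holomorphic[OF cov(1) open_ball hol(1) hol(2) im h(2) h(1) h(4)] .
  have "(\<pi> has_field_derivative deriv \<pi> z) (at (h y))"
    using hol(1) 1(2) h(3) by (simp add: holomorphic_derivI)
  moreover have "(h has_field_derivative deriv h y) (at y)"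
    using holh 2(2) by (simp add: holomorphic_derivI)
  ultimately have "((\<lambda>x. \<pi> (h x)) has_field_derivative deriv \<pi> z * deriv h y) (at y)"
    by (rule DERIV_chain2)
  then have "(\<rho> has_field_derivative deriv \<pi> z * deriv h y) (at y)"
    by (rule has_field_derivative_transform_within_open[OF _ open_ball 2(2)]) (use h(4) in auto)
  then have dr: "deriv \<rho> y = deriv \<pi> z * deriv h y"
    by (rule DERIV_imp_deriv)
  have "norm (deriv h y) * hyp_disk z \<le> hyp_disk y"
    using schwarz_pick[OF holh h(2) 2(2)] h(3) by simp
  also have "hyp_disk z = d * norm (deriv \<pi> z)" using 1(3) by simp
  also have "hyp_disk y = e * norm (deriv \<rho> y)" using 2(3) by simp
  finally have "d * norm (deriv \<rho> y) \<le> e * norm (deriv \<rho> y)"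
    by (simp add: dr norm_mult mult.commute mult.left_commute)
  moreover have "norm (deriv \<rho> y) > 0"
    using disk_covering_deriv_nonzero[OF 2(1,2)] by simp
  ultimately show ?thesis by simp
qed

lemma hyp_density_covering:
  assumes "disk_universal_covering \<pi> G" "z \<in> ball 0 1"
  shows "hyp_density G (\<pi> z) * norm (deriv \<pi> z) = hyp_disk z"
proof -
  define d where "d = hyp_disk z / norm (deriv \<pi> z)"
  have d: "d * norm (deriv \<pi> z) = hyp_disk z"
    using disk_covering_deriv_nonzero[OF assms] by (simp add: d_def)
  have "hyp_density G (\<pi> z) = d"
    unfolding hyp_density_def
  proof (rule the_equality)
    show "\<exists>\<rho> y. disk_universal_covering \<rho> G \<and> y \<in> ball 0 1 \<and> \<rho> y = \<pi> z \<and>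
            d * norm (deriv \<rho> y) = hyp_disk y"
      using assms d by blast
  next
    fix e assume "\<exists>\<rho> y. disk_universal_covering \<rho> G \<and> y \<in> ball 0 1 \<and> \<rho> y = \<pi> z \<and>
            e * norm (deriv \<rho> y) = hyp_disk y"
    then obtain \<rho> y where "disk_universal_covering \<rho> G" "y \<in> ball 0 1" "\<rho> y = \<pi> z"
            "e * norm (deriv \<rho> y) = hyp_disk y" by blast
    then show "e = d"
      using hyp_density_unique[OF assms d] hyp_density_unique[OF _ _ _ assms d]
      by (metis order_antisym)
  qed
  with d show ?thesis by simp
qed

text \<open>
  Complex n-space is \<open>complex ^ 'n\<close>, whose library norm is the Euclidean norm;
  \<open>*s\<close> is its complex scalar multiplication.
\<close>

definition hermitian :: "complex ^ 'n \<Rightarrow> complex ^ 'n \<Rightarrow> complex" where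
  "hermitian z w = (\<Sum>j\<in>UNIV. z $ j * cnj (w $ j))"

text \<open>For \<open>a = 0\<close> the quotient is \<open>0 / 0 = 0\<close>, so this is the zero map.\<close>

definition proj_line :: "complex ^ 'n \<Rightarrow> complex ^ 'n \<Rightarrow> complex ^ 'n" where
  "proj_line a z = (hermitian z a / hermitian a a) *s a"

definition s_ball :: "complex ^ 'n \<Rightarrow> real" where
  "s_ball a = sqrt (1 - (norm a)\<^sup>2)"

definition ball_aut :: "complex ^ 'n \<Rightarrow> complex ^ 'n \<Rightarrow> complex ^ 'n" where
  "ball_aut a z =
     (1 / (1 - hermitian z a)) *s
       (a - proj_line a z - s_ball a *\<^sub>R (z - proj_line a z))"

text \<open>Only meaningful for \<open>u \<noteq> 0\<close>; the value at \<open>u = 0\<close> is \<open>0\<close>.\<close>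

definition M_ball :: "complex ^ 'n \<Rightarrow> complex ^ 'n \<Rightarrow> real" where
  "M_ball a u = norm (frechet_derivative (ball_aut a) (at a) u) / norm u"

text \<open>Complex differentiability: the real Frechet derivative exists and is complex-linear.\<close>

definition analytic_map_on :: "(complex ^ 'n \<Rightarrow> complex) \<Rightarrow> (complex ^ 'n) set \<Rightarrow> bool" where
  "analytic_map_on f S \<longleftrightarrow>
     (\<forall>z\<in>S. \<exists>L. (f has_derivative L) (at z) \<and> Vector_Spaces.linear (*s) (*) L)"

definition partial_deriv :: "'n \<Rightarrow> (complex ^ 'n \<Rightarrow> complex) \<Rightarrow> complex ^ 'n \<Rightarrow> complex" where
  "partial_deriv j f z = deriv (\<lambda>t. f (\<chi> i. if i = j then t else z $ i)) (z $ j)"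

definition complex_gradient :: "(complex ^ 'n \<Rightarrow> complex) \<Rightarrow> complex ^ 'n \<Rightarrow> complex ^ 'n" where
  "complex_gradient f z = (\<chi> j. partial_deriv j f z)"

definition invariant_gradient :: "(complex ^ 'n \<Rightarrow> complex) \<Rightarrow> complex ^ 'n \<Rightarrow> complex ^ 'n" where
  "invariant_gradient f a = complex_gradient (f \<circ> ball_aut a) 0"

end

theory Submission
  imports Defs
begin

text \<open>
  A covering of \<open>G\<close> by the disk lifts every holomorphic disk in \<open>G\<close> to a self-map of the unit
  disk, so the Schwarz-Pick lemma on complex lines through the origin gives the inequality at the
  centre of the ball. Precomposing \<open>f\<close> with the automorphism \<open>\<phi>\<^sub>a\<close> moves it to \<open>a\<close>, because
  \<open>d\<phi>\<^sub>a(0) \<circ> d\<phi>\<^sub>a(a)\<close> is the identity; (ii) is the case of the direction conjugate to the gradient.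
\<close>

section \<open>The Hermitian form and complex scalar multiplication\<close>

lemma hermitian_add_left: "hermitian (x + y) z = hermitian x z + hermitian y z"
  by (simp add: hermitian_def sum.distrib ring_distribs)

lemma hermitian_diff_left: "hermitian (x - y) z = hermitian x z - hermitian y z"
  by (simp add: hermitian_def sum_subtractf ring_distribs)

lemma hermitian_scale_left: "hermitian (c *s x) z = c * hermitian x z"
  by (simp add: hermitian_def sum_distrib_left mult.assoc)

lemma hermitian_scaleR_left: "hermitian (r *\<^sub>R x) z = r *\<^sub>R hermitian x z"
  by (simp add: hermitian_def scaleR_sum_right)

lemma cnj_hermitian: "cnj (hermitian x y) = hermitian y x"
  by (simp add: hermitian_def mult.commute)

lemma hermitian_self: "hermitian x x = of_real ((norm x)\<^sup>2)"
  by (simp add: hermitian_def norm_vec_def L2_set_def sum_nonneg flip: complex_norm_square)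

lemma norm_hermitian_le: "norm (hermitian x y) \<le> norm x * norm y"
proof -
  have "norm (hermitian x y) \<le> (\<Sum>j\<in>UNIV. norm (x $ j) * norm (y $ j))"
    unfolding hermitian_def by (rule order_trans[OF norm_sum]) (simp add: norm_mult)
  also have "\<dots> \<le> norm x * norm y"
    unfolding norm_vec_def using L2_set_mult_ineq[of "\<lambda>j. norm (x $ j)" "\<lambda>j. norm (y $ j)" UNIV]
    by simp
  finally show ?thesis .
qed

lemma norm_vector_scalar_mult: "norm (c *s (x :: complex ^ 'n)) = norm c * norm x"
  by (simp add: norm_vec_def norm_mult L2_set_right_distrib)

lemma pythagoras_hermitian:
  assumes "hermitian x y = 0"
  shows "(norm (x + y))\<^sup>2 = (norm x)\<^sup>2 + (norm y)\<^sup>2"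
proof -
  have yx: "hermitian y x = 0" using cnj_hermitian[of x y] assms by simp
  have "hermitian x (x + y) = hermitian x x" "hermitian y (x + y) = hermitian y y"
    using cnj_hermitian[of "x + y" x] cnj_hermitian[of "x + y" y]
    by (simp_all add: hermitian_add_left assms yx cnj_hermitian)
  then have "hermitian (x + y) (x + y) = hermitian x x + hermitian y y"
    by (simp add: hermitian_add_left)
  then show ?thesis unfolding hermitian_self by (simp only: of_real_eq_iff flip: of_real_add)
qed

lemma bounded_linear_hermitian: "bounded_linear (\<lambda>x. hermitian x y)"
  by (rule bounded_linear_intro[of _ "norm y"])
     (simp_all add: hermitian_add_left hermitian_scaleR_left norm_hermitian_le)

text \<open>Supplies the product rule for the quotient in \<open>ball_aut\<close> and the derivative
  of \<open>t *s v\<close> in \<open>t\<close>.\<close>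

lemma bounded_bilinear_vector_scalar_mult:
  "bounded_bilinear ((*s) :: complex \<Rightarrow> complex ^ 'n \<Rightarrow> complex ^ 'n)"
proof
  show "\<exists>K. \<forall>c (x :: complex ^ 'n). norm (c *s x) \<le> norm c * norm x * K"
    by (rule exI[of _ 1]) (simp add: norm_vector_scalar_mult)
qed (simp_all add: vec_eq_iff ring_distribs)

lemma scaleR_eq_vector_scalar_mult: "r *\<^sub>R (x :: complex ^ 'n) = (of_real r :: complex) *s x"
  by (simp add: vec_eq_iff) (simp add: scaleR_conv_of_real)

lemma complex_linear_iff:
  fixes L :: "complex ^ 'n \<Rightarrow> complex"
  shows "Vector_Spaces.linear (*s) (*) L \<longleftrightarrow>
    (\<forall>x y. L (x + y) = L x + L y) \<and> (\<forall>c x. L (c *s x) = c * L x)"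
  by (simp add: Vector_Spaces.linear_iff vec.vector_space_axioms
      vector_space_over_itself.vector_space_axioms)

section \<open>Orthogonal projection onto a complex line\<close>

lemma proj_line_add: "proj_line a (x + y) = proj_line a x + proj_line a y"
  by (simp add: proj_line_def hermitian_add_left add_divide_distrib vec.scale_left_distrib)

lemma proj_line_scale: "proj_line a (c *s x) = c *s proj_line a x"
  by (simp add: proj_line_def hermitian_scale_left)

lemma proj_line_self: "proj_line a a = a"
  by (cases "a = 0") (simp_all add: proj_line_def hermitian_self)

lemma hermitian_zero_right: "hermitian x 0 = 0"
  by (simp add: hermitian_def)

lemma hermitian_proj_line: "hermitian (proj_line a x) a = hermitian x a"
  by (cases "a = 0")
     (simp_all add: proj_line_def hermitian_scale_left hermitian_self hermitian_zero_right)

text \<open>Clears the denominator of \<open>proj_line\<close>; at \<open>a = 0\<close> both sides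
  vanish. It turns the rank-one term of the derivative at 0 into a multiple of the
  projection.\<close>

lemma hermitian_scale_self: "hermitian x a *s a = of_real ((norm a)\<^sup>2) *s proj_line a x"
  by (cases "a = 0") (simp_all add: proj_line_def hermitian_self)

lemma proj_line_idem: "proj_line a (proj_line a x) = proj_line a x"
  by (subst (1 3) proj_line_def) (simp add: hermitian_proj_line)

text \<open>The scalar \<open>c\<close> stays free so that \<open>c *s a\<close> can be
  \<open>proj_line a x\<close> itself or the component along \<open>a\<close> of the numerator of
  \<open>ball_aut\<close>.\<close>

lemma proj_line_orthogonal: "hermitian (c *s a) (x - proj_line a x) = 0"
proof -
  have "hermitian (x - proj_line a x) a = 0"
    by (simp add: hermitian_diff_left hermitian_proj_line)
  then show ?thesis
    using cnj_hermitian[of "x - proj_line a x" a] by (simp add: hermitian_scale_left)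
qed

lemma norm_proj_line_decomp:
  "(norm x)\<^sup>2 = (norm (proj_line a x))\<^sup>2 + (norm (x - proj_line a x))\<^sup>2"
  using pythagoras_hermitian[of "proj_line a x" "x - proj_line a x"]
    proj_line_orthogonal[of "hermitian x a / hermitian a a" a x]
  by (simp flip: proj_line_def)

lemma bounded_linear_proj_line: "bounded_linear (proj_line a)"
proof (rule bounded_linear_intro[of _ 1])
  show "norm (proj_line a x) \<le> norm x * 1" for x
    by (rule power2_le_imp_le) (simp_all add: norm_proj_line_decomp[of x a])
qed (simp_all add: proj_line_add proj_line_scale scaleR_eq_vector_scalar_mult)

section \<open>Automorphisms of the ball\<close>

lemma s_ball_squared:
  assumes "a \<in> ball 0 1"
  shows "(s_ball a)\<^sup>2 = 1 - (norm a)\<^sup>2" and "0 < s_ball a" and "s_ball a \<le> 1"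
  using assms by (auto simp: s_ball_def abs_square_less_1 abs_square_le_1)

lemma one_minus_hermitian_nonzero:
  assumes "a \<in> ball 0 1" "z \<in> ball 0 1"
  shows "1 - hermitian z a \<noteq> 0"
proof
  assume "1 - hermitian z a = 0"
  then have "hermitian z a = 1" by simp
  then have "1 \<le> norm z * norm a" using norm_hermitian_le[of z a] by simp
  moreover have "norm z * norm a < 1"
    using assms mult_strict_mono'[of "norm z" 1 "norm a" 1] by simp
  ultimately show False by simp
qed

text \<open>With N the numerator, |1 - <z,a>|^2 - |N|^2 = (1 - |a|^2)(1 - |z|^2), which is positive.
  The identity follows by splitting \<open>z\<close> and N into their components along
  \<open>a\<close> and orthogonal to it.\<close>

lemma ball_aut_in_ball:
  assumes a: "a \<in> ball 0 1" and z: "z \<in> ball 0 1"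
  shows "ball_aut a z \<in> ball 0 1"
proof -
  \<comment> \<open>For \<open>a = 0\<close> this is \<open>0 / 0 = 0\<close>, and the computation
    below covers that case too.\<close>
  define c where "c = hermitian z a / hermitian a a"
  define A where "A = (norm a)\<^sup>2"
  define q where "q = z - proj_line a z"
  define N where "N = a - proj_line a z - s_ball a *\<^sub>R q"
  have P: "proj_line a z = c *s a" by (simp add: proj_line_def c_def)
  have \<alpha>: "hermitian z a = c * of_real A"
    using hermitian_proj_line[of a z] by (simp add: P A_def hermitian_scale_left hermitian_self)
  have A: "A < 1" using a by (simp add: A_def abs_square_less_1)
  have zz: "(norm z)\<^sup>2 = (norm c)\<^sup>2 * A + (norm q)\<^sup>2"
    using norm_proj_line_decomp[of z a]
    by (simp add: P q_def A_def norm_vector_scalar_mult power_mult_distrib)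
  have N: "N = (1 - c) *s a + (- of_real (s_ball a)) *s q"
    by (simp add: N_def P scaleR_eq_vector_scalar_mult vec.scale_left_diff_distrib)
  have "hermitian q ((1 - c) *s a) = 0"
    using proj_line_orthogonal[of "1 - c" a z] cnj_hermitian[of "(1 - c) *s a" q]
    by (simp add: q_def)
  then have "hermitian ((- of_real (s_ball a)) *s q) ((1 - c) *s a) = 0"
    by (simp only: hermitian_scale_left mult_zero_right)
  then have "(norm N)\<^sup>2 = (norm ((- of_real (s_ball a)) *s q))\<^sup>2 + (norm ((1 - c) *s a))\<^sup>2"
    using pythagoras_hermitian by (metis N add.commute)
  then have NN: "(norm N)\<^sup>2 = (norm (1 - c))\<^sup>2 * A + (1 - A) * (norm q)\<^sup>2"
    using s_ball_squared(1)[OF a]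
    by (simp only: norm_vector_scalar_mult power_mult_distrib norm_minus_cancel norm_of_real
        power2_abs A_def add.commute)
  \<comment> \<open>The terms linear in Re \<open>c\<close> cancel, and \<open>1 - A\<close> factors
    out of the rest.\<close>
  have "(norm (1 - hermitian z a))\<^sup>2 - (norm N)\<^sup>2 = (1 - A) * (1 - (norm z)\<^sup>2)"
    unfolding NN zz \<alpha> cmod_power2 by (simp add: power2_eq_square algebra_simps)
  moreover have "(1 - A) * (1 - (norm z)\<^sup>2) > 0"
    using A z by (intro mult_pos_pos) (simp_all add: abs_square_less_1)
  ultimately have "norm N < norm (1 - hermitian z a)"
    by (smt (verit) norm_ge_zero power_mono)
  moreover have "ball_aut a z = (1 / (1 - hermitian z a)) *s N"
    by (simp add: ball_aut_def N_def q_def)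
  ultimately show ?thesis
    using one_minus_hermitian_nonzero[OF a z]
    by (simp add: norm_vector_scalar_mult norm_divide)
qed

lemma ball_aut_zero: "ball_aut a 0 = a"
  by (simp add: ball_aut_def proj_line_def hermitian_def)

section \<open>The derivative of the automorphism\<close>

text \<open>The product rule for \<open>ball_aut\<close>: the first summand differentiates the
  numerator, the second the scalar factor.\<close>

definition ball_aut_deriv :: "complex ^ 'n \<Rightarrow> complex ^ 'n \<Rightarrow> complex ^ 'n \<Rightarrow> complex ^ 'n" where
  "ball_aut_deriv a z h =
     (1 / (1 - hermitian z a)) *s (- proj_line a h - s_ball a *\<^sub>R (h - proj_line a h)) +
     (hermitian h a / (1 - hermitian z a)\<^sup>2) *s
       (a - proj_line a z - s_ball a *\<^sub>R (z - proj_line a z))"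

lemma ball_aut_has_derivative:
  assumes "a \<in> ball 0 1" "z \<in> ball 0 1"
  shows "(ball_aut a has_derivative ball_aut_deriv a z) (at z)"
proof -
  note nz = one_minus_hermitian_nonzero[OF assms]
  have 1: "((\<lambda>x. 1 / (1 - hermitian x a)) has_derivative
      (\<lambda>h. hermitian h a / (1 - hermitian z a)\<^sup>2)) (at z)"
    using nz by (auto intro!: derivative_eq_intros
        bounded_linear.has_derivative[OF bounded_linear_hermitian]
        simp: power2_eq_square field_simps)
  have 2: "((\<lambda>x. a - proj_line a x - s_ball a *\<^sub>R (x - proj_line a x)) has_derivative
      (\<lambda>h. - proj_line a h - s_ball a *\<^sub>R (h - proj_line a h))) (at z)"
    by (auto intro!: derivative_eq_intros
        bounded_linear.has_derivative[OF bounded_linear_proj_line])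
  show ?thesis
    using bounded_bilinear.FDERIV[OF bounded_bilinear_vector_scalar_mult 1 2]
    unfolding ball_aut_def[abs_def] ball_aut_deriv_def[abs_def] .
qed

lemma ball_aut_deriv_add: "ball_aut_deriv a z (x + y) = ball_aut_deriv a z x + ball_aut_deriv a z y"
  by (simp add: ball_aut_deriv_def proj_line_add hermitian_add_left vec_eq_iff add_divide_distrib
      algebra_simps)

lemma ball_aut_deriv_scale: "ball_aut_deriv a z (c *s x) = c *s ball_aut_deriv a z x"
  by (simp add: ball_aut_deriv_def proj_line_scale hermitian_scale_left
      scaleR_eq_vector_scalar_mult vec_eq_iff algebra_simps)

text \<open>At 0 the numerator is \<open>a\<close>, so the second summand is |a|^2 times the
  projection of \<open>h\<close>, which combines with the minus projection of the first
  summand.\<close>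

lemma ball_aut_deriv_zero:
  assumes "a \<in> ball 0 1"
  shows "ball_aut_deriv a 0 h =
    - ((s_ball a)\<^sup>2 *\<^sub>R proj_line a h + s_ball a *\<^sub>R (h - proj_line a h))"
proof -
  have "hermitian 0 a = 0" "proj_line a 0 = 0" by (simp_all add: hermitian_def proj_line_def)
  then have "ball_aut_deriv a 0 h =
      - proj_line a h - s_ball a *\<^sub>R (h - proj_line a h) + hermitian h a *s a"
    by (simp add: ball_aut_deriv_def)
  then show ?thesis
    unfolding hermitian_scale_self s_ball_squared(1)[OF assms]
    unfolding scaleR_eq_vector_scalar_mult[symmetric] by (simp add: algebra_simps)
qed

text \<open>The numerator vanishes at \<open>a\<close>, so only the first summand survives, with
  scalar factor \<open>1 / (s_ball a)\<^sup>2\<close>.\<close>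

lemma ball_aut_deriv_self:
  assumes "a \<in> ball 0 1"
  shows "ball_aut_deriv a a h =
    - ((1 / (s_ball a)\<^sup>2) *\<^sub>R proj_line a h + (1 / s_ball a) *\<^sub>R (h - proj_line a h))"
proof -
  have "1 - hermitian a a = of_real ((s_ball a)\<^sup>2)"
    by (simp add: hermitian_self s_ball_squared(1)[OF assms])
  then have "ball_aut_deriv a a h =
      (1 / (s_ball a)\<^sup>2) *\<^sub>R (- proj_line a h - s_ball a *\<^sub>R (h - proj_line a h))"
    by (simp add: ball_aut_deriv_def proj_line_self scaleR_eq_vector_scalar_mult)
  then show ?thesis
    using s_ball_squared(2)[OF assms]
    by (simp add: scaleR_diff_right power2_eq_square)
qed

text \<open>Both derivatives act as scalars on the line of \<open>a\<close> and on its complement,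
  and the scalars are reciprocal: -s^2 and -1/s^2 on the line, -s and -1/s on the
  complement.\<close>

lemma ball_aut_deriv_inverse:
  assumes "a \<in> ball 0 1"
  shows "ball_aut_deriv a 0 (ball_aut_deriv a a h) = h"
proof -
  let ?w = "ball_aut_deriv a a h" and ?s = "s_ball a"
  have Pw: "proj_line a ?w = - ((1 / ?s\<^sup>2) *\<^sub>R proj_line a h)"
    unfolding ball_aut_deriv_self[OF assms]
    by (simp add: linear_simps[OF bounded_linear_proj_line] proj_line_idem)
  moreover have "?w - proj_line a ?w = - ((1 / ?s) *\<^sub>R (h - proj_line a h))"
    unfolding Pw unfolding ball_aut_deriv_self[OF assms] by simp
  ultimately show ?thesis
    unfolding ball_aut_deriv_zero[OF assms] using s_ball_squared(2)[OF assms] by simp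
qed

text \<open>Since s is at most 1, the stretching factor 1/s on the complement is at most the factor
  1/s^2 on the line. This is the source of the constant in (i).\<close>

lemma norm_ball_aut_deriv_self_le:
  assumes "a \<in> ball 0 1"
  shows "norm (ball_aut_deriv a a h) \<le> norm h / (s_ball a)\<^sup>2"
proof -
  let ?s = "s_ball a" and ?p = "proj_line a h" and ?q = "h - proj_line a h"
  note s = s_ball_squared(2,3)[OF assms]
  have w: "ball_aut_deriv a a h = (- 1 / ?s\<^sup>2) *\<^sub>R (?p + ?s *\<^sub>R ?q)"
    unfolding ball_aut_deriv_self[OF assms] using s(1)
    by (simp add: scaleR_add_right power2_eq_square)
  have "hermitian ?q ?p = 0"
    using proj_line_orthogonal[of "hermitian h a / hermitian a a" a h] cnj_hermitian[of ?p ?q]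
    by (simp flip: proj_line_def)
  then have "hermitian (?s *\<^sub>R ?q) ?p = 0"
    by (simp only: hermitian_scaleR_left scaleR_zero_right)
  then have "(norm (?p + ?s *\<^sub>R ?q))\<^sup>2 = ?s\<^sup>2 * (norm ?q)\<^sup>2 + (norm ?p)\<^sup>2"
    using pythagoras_hermitian[of "?s *\<^sub>R ?q" ?p] by (simp add: add.commute power_mult_distrib)
  also have "\<dots> \<le> (norm h)\<^sup>2"
    unfolding norm_proj_line_decomp[of h a] using s
    by (simp add: mult_left_le_one_le power_le_one)
  finally have "norm (?p + ?s *\<^sub>R ?q) \<le> norm h" by (rule power2_le_imp_le) simp
  then show ?thesis
    unfolding w by (simp add: divide_right_mono)
qed

section \<open>Analytic maps under automorphisms and on complex lines\<close>

lemma analytic_map_on_ball_aut: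
  assumes a: "a \<in> ball 0 1" and f: "analytic_map_on f (ball 0 1)"
  shows "analytic_map_on (f \<circ> ball_aut a) (ball 0 1)"
  unfolding analytic_map_on_def
proof
  fix z :: "complex ^ 'a" assume z: "z \<in> ball 0 1"
  obtain L where L: "(f has_derivative L) (at (ball_aut a z))" "Vector_Spaces.linear (*s) (*) L"
    using f ball_aut_in_ball[OF a z] unfolding analytic_map_on_def by blast
  have "(f \<circ> ball_aut a has_derivative L \<circ> ball_aut_deriv a z) (at z)"
    using diff_chain_at[OF ball_aut_has_derivative[OF a z] L(1)] .
  moreover have "Vector_Spaces.linear (*s) (*) (L \<circ> ball_aut_deriv a z)"
    using L(2) by (simp add: complex_linear_iff ball_aut_deriv_add ball_aut_deriv_scale)
  ultimately show "\<exists>L. (f \<circ> ball_aut a has_derivative L) (at z) \<and> Vector_Spaces.linear (*s) (*) L"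
    by blast
qed

text \<open>Complex linearity of \<open>L\<close> makes the derivative of the slice multiplication
  by \<open>L v\<close>. This serves both the holomorphic disks in Schwarz-Pick and the partial
  derivatives in the gradient.\<close>

lemma complex_line_has_field_derivative:
  fixes f :: "complex ^ 'n \<Rightarrow> complex"
  assumes "(f has_derivative L) (at (t *s v))" and "Vector_Spaces.linear (*s) (*) L"
  shows "((\<lambda>t. f (t *s v)) has_field_derivative L v) (at t)"
proof -
  have "((\<lambda>t. t *s v) has_derivative (\<lambda>t. t *s v)) (at t)"
    by (rule bounded_linear_imp_has_derivative
        [OF bounded_bilinear.bounded_linear_left[OF bounded_bilinear_vector_scalar_mult]])
  moreover have "(\<lambda>t. L (t *s v)) = (*) (L v)"
    using assms(2) by (simp add: complex_linear_iff fun_eq_iff)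
  ultimately show ?thesis
    using has_derivative_compose[of "\<lambda>t. t *s v" _ t UNIV f L] assms(1)
    unfolding has_field_derivative_def by metis
qed

section \<open>Schwarz-Pick for maps into a hyperbolic domain\<close>

lemma hyp_density_pos:
  assumes "hyperbolic_domain G" "w \<in> G"
  shows "hyp_density G w > 0"
proof -
  obtain \<pi> where \<pi>: "disk_universal_covering \<pi> G"
    using assms by (auto simp: hyperbolic_domain_def)
  then have "\<pi> ` ball 0 1 = G"
    unfolding disk_universal_covering_def by (blast dest: covering_space_imp_surjective)
  then obtain z where z: "z \<in> ball 0 1" "\<pi> z = w"
    using assms(2) by blast
  have "hyp_disk z > 0" using z(1) by (simp add: hyp_disk_def abs_square_less_1)
  then show ?thesis
    using hyp_density_covering[OF \<pi> z(1)] z(2) by (smt (verit) norm_ge_zero mult_nonpos_nonneg)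
qed

text \<open>Write \<open>k\<close> as the covering composed with a lift \<open>h\<close>. The factor
  |\<open>deriv \<pi> y\<close>| is absorbed by \<open>hyp_density_covering\<close>, which leaves
  the Schwarz-Pick inequality for \<open>h\<close>.\<close>

lemma hyp_density_disk_map:
  assumes "hyperbolic_domain G"
    and k: "k holomorphic_on ball 0 1" "k \<in> ball 0 1 \<rightarrow> G" and z: "z \<in> ball 0 1"
  shows "hyp_density G (k z) * norm (deriv k z) \<le> hyp_disk z"
proof -
  obtain \<pi> where \<pi>: "disk_universal_covering \<pi> G"
    using assms by (auto simp: hyperbolic_domain_def)
  then have cov: "covering_space (ball 0 1) \<pi> G" and hol: "\<pi> holomorphic_on ball 0 1"
    by (auto simp: disk_universal_covering_def)
  have "k z \<in> G" using k(2) z by auto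
  then obtain y where y: "y \<in> ball 0 1" "\<pi> y = k z"
    using covering_space_imp_surjective[OF cov] by (metis imageE)
  \<comment> \<open>The disk is convex, hence simply connected and locally path connected, so the
    lift exists with the prescribed value at \<open>z\<close>.\<close>
  obtain h where h: "continuous_on (ball 0 1) h" "h \<in> ball 0 1 \<rightarrow> ball 0 1" "h z = y"
      "\<And>x. x \<in> ball 0 1 \<Longrightarrow> \<pi> (h x) = k x"
    using covering_space_lift_strong[OF cov y(1) z, of k] k y(2)
    by (metis convex_ball convex_imp_locally_path_connected convex_imp_simply_connected
        holomorphic_on_imp_continuous_on)
  have holh: "h holomorphic_on ball 0 1"
    using covering_space_lift_is_holomorphic[OF cov open_ball hol k(1,2) h(2) h(1) h(4)] .
  have "(\<pi> has_field_derivative deriv \<pi> y) (at (h z))"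
    using hol y(1) h(3) by (simp add: holomorphic_derivI)
  moreover have "(h has_field_derivative deriv h z) (at z)"
    using holh z by (simp add: holomorphic_derivI)
  ultimately have "((\<lambda>x. \<pi> (h x)) has_field_derivative deriv \<pi> y * deriv h z) (at z)"
    by (rule DERIV_chain2)
  then have "(k has_field_derivative deriv \<pi> y * deriv h z) (at z)"
    by (rule has_field_derivative_transform_within_open[OF _ open_ball z]) (use h(4) in auto)
  then have "deriv k z = deriv \<pi> y * deriv h z"
    by (rule DERIV_imp_deriv)
  then have "hyp_density G (k z) * norm (deriv k z) = norm (deriv h z) * hyp_disk (h z)"
    using hyp_density_covering[OF \<pi> y(1)] y(2) h(3)
    by (simp add: norm_mult mult.commute mult.left_commute)
  then show ?thesis using schwarz_pick[OF holh h(2) z] by simp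
qed

text \<open>Restrict \<open>g\<close> to the disk in the direction of \<open>v\<close>; the constant
  2 is \<open>hyp_disk 0\<close>.\<close>

lemma hyp_density_ball_map_centre:
  assumes G: "hyperbolic_domain G" and g: "analytic_map_on g (ball 0 1)" "g \<in> ball 0 1 \<rightarrow> G"
    and L: "(g has_derivative L) (at 0)" "Vector_Spaces.linear (*s) (*) L"
  shows "hyp_density G (g 0) * norm (L v) \<le> 2 * norm v"
proof (cases "v = 0")
  case True
  then show ?thesis using linear_simps[OF has_derivative_bounded_linear[OF L(1)]] by simp
next
  case False
  \<comment> \<open>A unit vector, so that \<open>t *s e\<close> runs through the ball exactly when
    \<open>t\<close> runs through the unit disk.\<close>
  define e where "e = (1 / of_real (norm v) :: complex) *s v"
  have ne: "norm e = 1" and ve: "v = of_real (norm v) *s e"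
    using False by (simp_all add: e_def norm_vector_scalar_mult norm_divide)
  define k where "k t = g (t *s e)" for t
  have in_ball: "t *s e \<in> ball 0 1" if "t \<in> ball 0 1" for t
    using that ne by (simp add: norm_vector_scalar_mult)
  have "k holomorphic_on ball 0 1"
    unfolding holomorphic_on_open[OF open_ball]
  proof
    fix t :: complex assume "t \<in> ball 0 1"
    then obtain L' where "(g has_derivative L') (at (t *s e))" "Vector_Spaces.linear (*s) (*) L'"
      using in_ball g(1) unfolding analytic_map_on_def by blast
    then show "\<exists>d. (k has_field_derivative d) (at t)"
      unfolding k_def[abs_def] using complex_line_has_field_derivative by blast
  qed
  moreover have "k \<in> ball 0 1 \<rightarrow> G"
    using in_ball g(2) unfolding k_def by blast
  ultimately have "hyp_density G (k 0) * norm (deriv k 0) \<le> hyp_disk 0"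
    by (rule hyp_density_disk_map[OF G]) simp
  moreover have "(k has_field_derivative L e) (at 0)"
    unfolding k_def[abs_def] using L by (intro complex_line_has_field_derivative) simp_all
  then have "deriv k 0 = L e" by (rule DERIV_imp_deriv)
  ultimately have "hyp_density G (g 0) * norm (L e) \<le> 2"
    by (simp add: k_def hyp_disk_def)
  moreover have "norm (L v) = norm v * norm (L e)"
    using L(2) by (subst ve) (simp add: complex_linear_iff norm_mult)
  ultimately show ?thesis
    using mult_left_mono[of "hyp_density G (g 0) * norm (L e)" 2 "norm v"]
    by (simp add: mult.commute mult.left_commute)
qed

section \<open>The complex gradient at the origin\<close>

lemma complex_linear_expansion:
  fixes L :: "complex ^ 'n \<Rightarrow> complex"
  assumes "Vector_Spaces.linear (*s) (*) L"
  shows "L v = (\<Sum>j\<in>UNIV. v $ j * L (axis j 1))"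
proof -
  interpret L: Vector_Spaces.linear "(*s)" "(*)" L by fact
  have "L v = L (\<Sum>j\<in>UNIV. v $ j *s axis j 1)" by (simp add: basis_expansion)
  then show ?thesis by (simp add: L.sum L.scale)
qed

text \<open>At the origin, varying the j-th coordinate alone is the slice
  \<open>t *s axis j 1\<close>, so each partial derivative is a value of \<open>L\<close>.\<close>

lemma complex_gradient_zero:
  assumes "(g has_derivative L) (at 0)" "Vector_Spaces.linear (*s) (*) L"
  shows "complex_gradient g 0 $ j = L (axis j 1)"
proof -
  have "(\<chi> i. if i = j then t else (0 :: complex ^ 'a) $ i) = t *s axis j 1" for t
    by (simp add: vec_eq_iff axis_def)
  moreover have "((\<lambda>t. g (t *s axis j 1)) has_field_derivative L (axis j 1)) (at 0)"
    using assms by (intro complex_line_has_field_derivative) simp_all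
  ultimately show ?thesis
    by (simp add: complex_gradient_def partial_deriv_def DERIV_imp_deriv)
qed

section \<open>The inequalities at an arbitrary point\<close>

theorem theorem12:
  fixes G :: "complex set" and f :: "complex ^ 'n \<Rightarrow> complex"
  assumes "hyperbolic_domain G"
    and "analytic_map_on f (ball 0 1)"
    and "f \<in> ball 0 1 \<rightarrow> G"
  shows "(\<forall>a\<in>ball 0 1. \<forall>u.
            hyp_density G (f a) * norm (frechet_derivative f (at a) u)
              \<le> 2 * (M_ball a u * norm u)) \<and>
         (\<forall>z\<in>ball 0 1.
            hyp_density G (f z) * onorm (frechet_derivative f (at z)) \<le> 2 / (s_ball z)\<^sup>2) \<and>
         (\<forall>z\<in>ball 0 1.
            hyp_density G (f z) * norm (invariant_gradient f z) \<le> 2)"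
proof -
  \<comment> \<open>\<open>L'\<close> is the derivative at 0 of the map moved to the centre. The
    bound on \<open>L'\<close> gives (ii), and the factorization of the derivative of
    \<open>f\<close> at \<open>a\<close> through \<open>L'\<close> gives the main
    inequality.\<close>
  have centre: "\<exists>L'. (f \<circ> ball_aut a has_derivative L') (at 0) \<and>
      Vector_Spaces.linear (*s) (*) L' \<and>
      (\<forall>v. hyp_density G (f a) * norm (L' v) \<le> 2 * norm v) \<and>
      (\<forall>u. frechet_derivative f (at a) u = L' (ball_aut_deriv a a u))"
    if a: "a \<in> ball 0 1" for a
  proof -
    let ?g = "f \<circ> ball_aut a"
    obtain L where L: "(f has_derivative L) (at a)" "Vector_Spaces.linear (*s) (*) L"
      using assms(2) a unfolding analytic_map_on_def by blast
    have fL: "frechet_derivative f (at a) = L"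
      using frechet_derivative_at[OF L(1)] by simp
    have g: "analytic_map_on ?g (ball 0 1)"
      by (rule analytic_map_on_ball_aut[OF a assms(2)])
    have gG: "?g \<in> ball 0 1 \<rightarrow> G"
      using assms(3) ball_aut_in_ball[OF a] by (auto simp: Pi_iff)
    let ?L = "L \<circ> ball_aut_deriv a 0"
    have d: "(?g has_derivative ?L) (at 0)"
      using diff_chain_at[OF ball_aut_has_derivative[OF a], of 0 f L] L(1) ball_aut_zero[of a]
      by simp
    have lin: "Vector_Spaces.linear (*s) (*) ?L"
      using L(2) by (simp add: complex_linear_iff ball_aut_deriv_add ball_aut_deriv_scale)
    have "hyp_density G (f a) * norm (?L v) \<le> 2 * norm v" for v
      using hyp_density_ball_map_centre[OF assms(1) g gG d lin, of v] by (simp add: ball_aut_zero)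
    moreover have "frechet_derivative f (at a) u = ?L (ball_aut_deriv a a u)" for u
      by (simp add: fL ball_aut_deriv_inverse[OF a])
    ultimately show ?thesis using d lin by blast
  qed
  have first: "hyp_density G (f a) * norm (frechet_derivative f (at a) u)
      \<le> 2 * norm (ball_aut_deriv a a u)" if "a \<in> ball 0 1" for a u
    using centre[OF that] by metis
  have M: "M_ball a u * norm u = norm (ball_aut_deriv a a u)"
    if a: "a \<in> ball 0 1" for a u :: "complex ^ 'n"
  proof -
    have "frechet_derivative (ball_aut a) (at a) = ball_aut_deriv a a"
      using frechet_derivative_at[OF ball_aut_has_derivative[OF a a]] by simp
    moreover have "ball_aut_deriv a a 0 = 0"
      using ball_aut_deriv_scale[of a a 0 0] by simp
    \<comment> \<open>At \<open>u = 0\<close> the quotient \<open>M_ball\<close> takes its default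
      value, but both sides are 0.\<close>
    ultimately show ?thesis by (cases "u = 0") (simp_all add: M_ball_def)
  qed
  show ?thesis
  proof (intro conjI ballI allI)
    fix a u :: "complex ^ 'n" assume "a \<in> ball 0 1"
    then show "hyp_density G (f a) * norm (frechet_derivative f (at a) u)
        \<le> 2 * (M_ball a u * norm u)"
      using first M by metis
  next
    fix z :: "complex ^ 'n" assume z: "z \<in> ball 0 1"
    let ?H = "hyp_density G (f z)"
    \<comment> \<open>Positivity allows dividing the pointwise bound by the density, passing to the
      operator norm, and multiplying back.\<close>
    have H: "?H > 0" using hyp_density_pos[OF assms(1)] assms(3) z by blast
    have "norm (frechet_derivative f (at z) u) \<le> 2 / (s_ball z)\<^sup>2 / ?H * norm u" for u
    proof -
      have "?H * norm (frechet_derivative f (at z) u) \<le> 2 * (norm u / (s_ball z)\<^sup>2)"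
        using first[OF z, of u] norm_ball_aut_deriv_self_le[OF z, of u] by simp
      then have "norm (frechet_derivative f (at z) u) \<le> 2 * (norm u / (s_ball z)\<^sup>2) / ?H"
        using H by (simp only: pos_le_divide_eq mult.commute)
      then show ?thesis by (simp add: mult.commute mult.left_commute)
    qed
    then have "onorm (frechet_derivative f (at z)) \<le> 2 / (s_ball z)\<^sup>2 / ?H"
      using H by (intro onorm_bound) simp_all
    then show "?H * onorm (frechet_derivative f (at z)) \<le> 2 / (s_ball z)\<^sup>2"
      using H by (simp only: pos_le_divide_eq mult.commute)
  next
    fix z :: "complex ^ 'n" assume z: "z \<in> ball 0 1"
    obtain L where L: "(f \<circ> ball_aut z has_derivative L) (at 0)" "Vector_Spaces.linear (*s) (*) L"
        and le: "\<And>v. hyp_density G (f z) * norm (L v) \<le> 2 * norm v"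
      using centre[OF z] by blast
    define D where "D = invariant_gradient f z"
    have D: "D $ j = L (axis j 1)" for j
      unfolding D_def invariant_gradient_def by (rule complex_gradient_zero[OF L])
    \<comment> \<open>The equality case of Cauchy-Schwarz: \<open>L v\<close> is the sum of the
      |D_j|^2, while \<open>v\<close> has the same norm as \<open>D\<close>.\<close>
    define v where "v = (\<chi> j. cnj (D $ j))"
    have nv: "norm v = norm D" by (simp add: v_def norm_vec_def)
    have "L v = hermitian D D"
      unfolding complex_linear_expansion[OF L(2), of v] hermitian_def
      by (simp add: v_def D mult.commute)
    then have "norm (L v) = (norm D)\<^sup>2" by (simp add: hermitian_self norm_power)
    then have "(hyp_density G (f z) * norm D) * norm D \<le> 2 * norm D"
      using le[of v] nv by (simp add: power2_eq_square mult.assoc)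
    \<comment> \<open>Cancels one factor \<open>norm D\<close>; for \<open>D = 0\<close> the claim
      is trivial.\<close>
    then have "hyp_density G (f z) * norm D \<le> 2"
      by (cases "D = 0") (simp_all add: mult_le_cancel_right)
    then show "hyp_density G (f z) * norm (invariant_gradient f z) \<le> 2"
      by (simp add: D_def)
  qed
qed

end
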